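(* Let $\lambda_1,\lambda_2,\lambda_3\in\mathbb{C}$ be pairwise distinct and different from $0,1$. Every Rosenhain tetrahedron determines an isomorphism between the Cassels-Flynn quartic with parameters $\lambda_1,\lambda_2,\lambda_3$ and a Rosenhain quartic.
   Context: Set $\lambda_4=0$, $\lambda_5=1$. The sixteen tropes are the planes in $\mathbb{P}^3(z_1,z_2,z_3,z_4)$ defined by the linear forms $$\mathsf{T}_i=\lambda_i^2z_1-\lambda_iz_2+z_3\ (1\le i\le5),\qquad \mathsf{T}_6=z_1,$$ $$\mathsf{T}_{ij6}=z_4-(\lambda_i+\lambda_j)z_3+\lambda_i\lambda_jz_2-\big(\lambda_i\lambda_j(\lambda_k+\lambda_l+\lambda_m)+\lambda_k\lambda_l\lambda_m\big)z_1\quad(1\le i<j\le5,\ \{i,j,k,l,m\}=\{1,\dots,5\}).$$ The Cassels-Flynn quartic is $K_2z_4^2+K_1z_4+K_0=0$, where $K_2=z_2^2-4z_1z_3$, $$K_1=-2\sigma_3z_1^2z_2+4(\sigma_3+\sigma_2)z_1^2z_3-2(\sigma_2+\sigma_1)z_1z_2z_3+4(1+\sigma_1)z_1z_3^2-2z_2z_3^2,$$ $\sigma_1,\sigma_2,\sigma_3$ are the elementary symmetric polynomials in $\lambda_1,\lambda_2,\lambda_3$, and $K_0=K_0(z_1,z_2,z_3)$ is the unique polynomial with $K_1^2-4K_0K_2=16\,\mathsf{T}_1\mathsf{T}_2\mathsf{T}_3\mathsf{T}_4\mathsf{T}_5\mathsf{T}_6$. It has sixteen nodes; each trope contains exactly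 six of them. A Rosenhain tetrahedron is a tetrahedron in $\mathbb{P}^3$ whose four faces are tropes and all of whose vertices are nodes. A Rosenhain quartic is the surface in $\mathbb{P}^3(Y_0,Y_1,Y_2,Y_3)$ given, for some $[a:b:c:d]\in\mathbb{P}^3$, by $$a^2(Y_0^2Y_1^2+Y_2^2Y_3^2)+b^2(Y_0^2Y_2^2+Y_1^2Y_3^2)+c^2(Y_0^2Y_3^2+Y_1^2Y_2^2)+2ab(Y_0Y_1-Y_2Y_3)(Y_0Y_2+Y_1Y_3)$$ $$-2ac(Y_0Y_1+Y_2Y_3)(Y_0Y_3+Y_1Y_2)+2bc(Y_0Y_2-Y_1Y_3)(Y_0Y_3-Y_1Y_2)+d^2Y_0Y_1Y_2Y_3=0.$$ *)

theory Defs
  imports "HOL-Analysis.Analysis"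
begin

text \<open>
  Points of \<open>\<bbbP>\<^sup>3\<close> are given by nonzero homogeneous coordinate vectors in \<^typ>\<open>complex ^ 4\<close>,
  planes of \<open>\<bbbP>\<^sup>3\<close> by their cones, i.e. three-dimensional subspaces of \<^typ>\<open>complex ^ 4\<close>.
  In the index type \<^typ>\<open>4\<close> the numerals are read modulo 4, so that \<open>0 = 4\<close>: the coordinates
  \<open>z\<^sub>1, \<dots>, z\<^sub>4\<close> are \<open>z $ 1, \<dots>, z $ 4\<close>, and \<open>Y\<^sub>0, \<dots>, Y\<^sub>3\<close> are \<open>Y $ 0, \<dots>, Y $ 3\<close>.
\<close>

subsection \<open>Polynomial functions, nodes, tetrahedra\<close>

text \<open>
  Polynomial functions in those coordinates whose index lies in \<open>I\<close>.  As the ground field is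
  infinite, polynomials and polynomial functions are the same thing.
\<close>

inductive polynomial_in :: "'n set \<Rightarrow> (complex ^ 'n \<Rightarrow> complex) \<Rightarrow> bool" for I where
  const: "polynomial_in I (\<lambda>z. c)"
| coord: "i \<in> I \<Longrightarrow> polynomial_in I (\<lambda>z. z $ i)"
| add: "polynomial_in I f \<Longrightarrow> polynomial_in I g \<Longrightarrow> polynomial_in I (\<lambda>z. f z + g z)"
| mult: "polynomial_in I f \<Longrightarrow> polynomial_in I g \<Longrightarrow> polynomial_in I (\<lambda>z. f z * g z)"

definition partial :: "'n \<Rightarrow> (complex ^ 'n \<Rightarrow> complex) \<Rightarrow> complex ^ 'n \<Rightarrow> complex" where
  "partial i F z = deriv (\<lambda>t. F (z + axis i t)) 0"

text \<open>
  A node of the surface \<open>F = 0\<close> (\<open>F\<close> homogeneous of degree at least 2) is an ordinary double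
  point: a singular point whose tangent cone is a nondegenerate quadratic cone.  At a singular
  point \<open>p\<close>, Euler's relation puts \<open>p\<close> in the kernel of the Hessian, which induces on
  \<open>\<complex>\<^sup>4/\<complex>p\<close> (twice) the quadratic form of the tangent cone; so the condition is rank 3.
\<close>

definition is_node :: "(complex ^ 4 \<Rightarrow> complex) \<Rightarrow> complex ^ 4 \<Rightarrow> bool" where
  "is_node F p \<longleftrightarrow> p \<noteq> 0 \<and> F p = 0 \<and> (\<forall>i. partial i F p = 0) \<and>
     rank ((\<chi> i j. partial i (partial j F) p) :: complex ^ 4 ^ 4) = 3"

definition is_plane :: "(complex ^ 4) set \<Rightarrow> bool" where
  "is_plane H \<longleftrightarrow> (\<exists>c :: complex ^ 4. c \<noteq> 0 \<and> H = {z. (\<Sum>i\<in>UNIV. c $ i * z $ i) = 0})"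

text \<open>
  A tetrahedron is given by its set of faces: four planes without a common point in \<open>\<bbbP>\<^sup>3\<close>.
  Its vertices are the points in which three of the faces meet; below, the set of all
  homogeneous coordinate vectors of the four vertices.
\<close>

definition tetrahedron :: "(complex ^ 4) set set \<Rightarrow> bool" where
  "tetrahedron S \<longleftrightarrow> card S = 4 \<and> (\<forall>H\<in>S. is_plane H) \<and> \<Inter>S = {0}"

definition vertices :: "(complex ^ 4) set set \<Rightarrow> (complex ^ 4) set" where
  "vertices S = {p. p \<noteq> 0 \<and> (\<exists>H\<in>S. p \<in> \<Inter>(S - {H}))}"

definition coordinate_tetrahedron :: "(complex ^ 4) set set" where
  "coordinate_tetrahedron = (\<lambda>i. {Y. Y $ i = 0}) ` UNIV"

text \<open>
  The projective transformation of \<open>\<bbbP>\<^sup>3\<close> with matrix \<open>A\<close> restricts to an isomorphism from the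
  surface \<open>F = 0\<close> onto the surface \<open>G = 0\<close>: it pulls back the equation \<open>G\<close> to a nonzero
  multiple of \<open>F\<close>.
\<close>

definition projective_isomorphism ::
    "complex ^ 4 ^ 4 \<Rightarrow> (complex ^ 4 \<Rightarrow> complex) \<Rightarrow> (complex ^ 4 \<Rightarrow> complex) \<Rightarrow> bool" where
  "projective_isomorphism A F G \<longleftrightarrow>
     invertible A \<and> (\<exists>k. k \<noteq> 0 \<and> (\<forall>z. G (A *v z) = k * F z))"


subsection \<open>Tropes\<close>

definition lam :: "complex \<Rightarrow> complex \<Rightarrow> complex \<Rightarrow> nat \<Rightarrow> complex" where
  "lam l1 l2 l3 i =
     (if i = 1 then l1 else if i = 2 then l2 else if i = 3 then l3 else if i = 4 then 0 else 1)"

definition trope_form ::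
    "complex \<Rightarrow> complex \<Rightarrow> complex \<Rightarrow> nat \<Rightarrow> complex ^ 4 \<Rightarrow> complex" where
  "trope_form l1 l2 l3 i z =
     (if i = 6 then z $ 1
      else (lam l1 l2 l3 i)\<^sup>2 * z $ 1 - lam l1 l2 l3 i * z $ 2 + z $ 3)"

text \<open>The form \<open>T\<^sub>i\<^sub>j\<^sub>6\<close>; the sum and the product run over \<open>{k, l, m} = {1, \<dots>, 5} - {i, j}\<close>.\<close>

definition trope_form6 ::
    "complex \<Rightarrow> complex \<Rightarrow> complex \<Rightarrow> nat \<Rightarrow> nat \<Rightarrow> complex ^ 4 \<Rightarrow> complex" where
  "trope_form6 l1 l2 l3 i j z =
     (let L = lam l1 l2 l3; R = {1..5} - {i, j} in
      z $ 4 - (L i + L j) * z $ 3 + L i * L j * z $ 2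
        - (L i * L j * (\<Sum>k\<in>R. L k) + (\<Prod>k\<in>R. L k)) * z $ 1)"

definition tropes :: "complex \<Rightarrow> complex \<Rightarrow> complex \<Rightarrow> (complex ^ 4) set set" where
  "tropes l1 l2 l3 =
     {{z. trope_form l1 l2 l3 i z = 0} | i. i \<in> {1..6}} \<union>
     {{z. trope_form6 l1 l2 l3 i j z = 0} | i j. 1 \<le> i \<and> i < j \<and> j \<le> 5}"


subsection \<open>The Cassels--Flynn quartic and the Rosenhain quartics\<close>

definition cf_K2 :: "complex ^ 4 \<Rightarrow> complex" where
  "cf_K2 z = (z $ 2)\<^sup>2 - 4 * z $ 1 * z $ 3"

definition cf_K1 :: "complex \<Rightarrow> complex \<Rightarrow> complex \<Rightarrow> complex ^ 4 \<Rightarrow> complex" where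
  "cf_K1 l1 l2 l3 z =
     (let s1 = l1 + l2 + l3; s2 = l1 * l2 + l1 * l3 + l2 * l3; s3 = l1 * l2 * l3;
          z1 = z $ 1; z2 = z $ 2; z3 = z $ 3 in
      - 2 * s3 * z1\<^sup>2 * z2 + 4 * (s3 + s2) * z1\<^sup>2 * z3 - 2 * (s2 + s1) * z1 * z2 * z3
        + 4 * (1 + s1) * z1 * z3\<^sup>2 - 2 * z2 * z3\<^sup>2)"

definition cf_K0 :: "complex \<Rightarrow> complex \<Rightarrow> complex \<Rightarrow> complex ^ 4 \<Rightarrow> complex" where
  "cf_K0 l1 l2 l3 =
     (THE K0. polynomial_in {1, 2, 3} K0 \<and>
        (\<forall>z. (cf_K1 l1 l2 l3 z)\<^sup>2 - 4 * K0 z * cf_K2 z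
               = 16 * (\<Prod>i\<in>{1..6}. trope_form l1 l2 l3 i z)))"

definition cassels_flynn :: "complex \<Rightarrow> complex \<Rightarrow> complex \<Rightarrow> complex ^ 4 \<Rightarrow> complex" where
  "cassels_flynn l1 l2 l3 z =
     cf_K2 z * (z $ 4)\<^sup>2 + cf_K1 l1 l2 l3 z * z $ 4 + cf_K0 l1 l2 l3 z"

definition rosenhain_tetrahedron ::
    "complex \<Rightarrow> complex \<Rightarrow> complex \<Rightarrow> (complex ^ 4) set set \<Rightarrow> bool" where
  "rosenhain_tetrahedron l1 l2 l3 S \<longleftrightarrow>
     tetrahedron S \<and> S \<subseteq> tropes l1 l2 l3 \<and>
     (\<forall>p\<in>vertices S. is_node (cassels_flynn l1 l2 l3) p)"

definition rosenhain_quartic ::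
    "complex \<Rightarrow> complex \<Rightarrow> complex \<Rightarrow> complex \<Rightarrow> complex ^ 4 \<Rightarrow> complex" where
  "rosenhain_quartic a b c d Y =
     (let Y0 = Y $ 0; Y1 = Y $ 1; Y2 = Y $ 2; Y3 = Y $ 3 in
      a\<^sup>2 * (Y0\<^sup>2 * Y1\<^sup>2 + Y2\<^sup>2 * Y3\<^sup>2) + b\<^sup>2 * (Y0\<^sup>2 * Y2\<^sup>2 + Y1\<^sup>2 * Y3\<^sup>2)
      + c\<^sup>2 * (Y0\<^sup>2 * Y3\<^sup>2 + Y1\<^sup>2 * Y2\<^sup>2)
      + 2 * a * b * (Y0 * Y1 - Y2 * Y3) * (Y0 * Y2 + Y1 * Y3)
      - 2 * a * c * (Y0 * Y1 + Y2 * Y3) * (Y0 * Y3 + Y1 * Y2)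
      + 2 * b * c * (Y0 * Y2 - Y1 * Y3) * (Y0 * Y3 - Y1 * Y2)
      + d\<^sup>2 * Y0 * Y1 * Y2 * Y3)"

end

theory Submission
  imports Defs
begin

text \<open>
  The reason for the theorem is that a quartic surface with four conics of contact in the faces
  of a tetrahedron and nodes at its vertices is almost determined by these data.  Take the
  faces of the Rosenhain tetrahedron as coordinate planes \<open>Y\<^sub>0, \<dots>, Y\<^sub>3 = 0\<close> and let \<open>G\<close> be the
  quartic in these coordinates.

  A trope touches the surface along a conic, so \<open>G\<close> restricts to the square of a quadratic form
  on each face (\<open>cassels_flynn_square_on_trope\<close>).  Three vertices lie on that face and on the
  surface, so the quadratic form contains only the three mixed products
  \<open>Y\<^sub>iY\<^sub>j\<close>.  By inclusion and exclusion \<open>G\<close> is recovered from its faces up to a multiple of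
  \<open>Y\<^sub>0Y\<^sub>1Y\<^sub>2Y\<^sub>3\<close> (\<open>quartic_determined_by_faces\<close>).  Two faces that share the edge \<open>ij\<close> agree there, so
  their coefficients of \<open>Y\<^sub>iY\<^sub>j\<close> agree up to sign; call them \<open>\<plusminus>p\<^sub>i\<^sub>j\<close>.

  The signs are decided by the vertices.  The tangent cone at a vertex has squares of three of
  the \<open>p\<^sub>i\<^sub>j\<close> on its diagonal, and the mixed coefficients are their products up to sign.  If the
  product of these three signs is \<open>+\<close>, or if one of the three \<open>p\<^sub>i\<^sub>j\<close> vanishes, then the cone is
  the square of a linear form and its Hessian has rank at most one; the vertex would not be a
  node (\<open>not_node_at_vertex\<close>).  Hence all \<open>p\<^sub>i\<^sub>j\<close> are nonzero, and after changes of sign of the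
  quadratic forms the signs are those of the Rosenhain quartic (\<open>tetrahedral_normal_form\<close>).

  What remains is that a Rosenhain quartic has equal coefficients on opposite edges.  The
  coordinates can be rescaled such that this holds (\<open>tetrahedral_quartic_rescaled\<close>): the three
  equations for the scaling factors are solved by square roots.
\<close>

section \<open>Polynomial functions\<close>

lemma polynomial_in_power: "polynomial_in I f \<Longrightarrow> polynomial_in I (\<lambda>z. f z ^ n)"
  by (induction n) (auto intro: polynomial_in.intros)

lemma polynomial_in_scale: "polynomial_in I f \<Longrightarrow> polynomial_in I (\<lambda>z. c * f z)"
  by (intro polynomial_in.intros)

lemma polynomial_in_minus: "polynomial_in I f \<Longrightarrow> polynomial_in I (\<lambda>z. - f z)"
  using polynomial_in_scale[of I f "-1"] by simp

lemma polynomial_in_diff: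
  "polynomial_in I f \<Longrightarrow> polynomial_in I g \<Longrightarrow> polynomial_in I (\<lambda>z. f z - g z)"
  using polynomial_in.add[OF _ polynomial_in_minus] by fastforce

lemmas polynomial_in_intros =
  polynomial_in.intros polynomial_in_power polynomial_in_minus polynomial_in_diff

lemma polynomial_in_continuous: "polynomial_in I f \<Longrightarrow> isCont f z"
  by (induction rule: polynomial_in.induct) (auto intro!: continuous_intros)

lemma polynomial_in_compose:
  assumes "polynomial_in I f" "\<And>i. i \<in> I \<Longrightarrow> polynomial_in J (\<lambda>z. T z $ i)"
  shows "polynomial_in J (\<lambda>z. f (T z))"
  using assms by (induction rule: polynomial_in.induct) (auto intro: polynomial_in.intros)

lemma polynomial_in_sum:
  "finite A \<Longrightarrow> (\<And>i. i \<in> A \<Longrightarrow> polynomial_in I (f i)) \<Longrightarrow> polynomial_in I (\<lambda>z. \<Sum>i\<in>A. f i z)"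
  by (induction rule: finite_induct) (auto intro: polynomial_in.intros)

lemma polynomial_in_matrix_vector: "polynomial_in UNIV (\<lambda>z. (A *v z) $ i)"
  unfolding matrix_vector_mult_def vec_lambda_beta
  by (intro polynomial_in_sum polynomial_in.intros) auto

section \<open>Singular points whose tangent cone is a square\<close>

lemma has_partial:
  assumes "polynomial_in I f"
  shows "((\<lambda>t. f (z + axis i t)) has_field_derivative partial i f z) (at 0)"
proof -
  have "(\<lambda>t. f (z + axis i t)) field_differentiable (at 0)"
    using assms
  proof (induction rule: polynomial_in.induct)
    case (coord j)
    then show ?case
      by (cases "j = i") (auto simp: axis_def intro!: derivative_intros)
  qed (auto intro!: derivative_intros)
  then show ?thesis
    unfolding partial_def by (simp add: DERIV_deriv_iff_field_differentiable)
qed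

lemma partial_const: "partial i (\<lambda>z. c) = (\<lambda>z. 0)"
  by (simp add: partial_def fun_eq_iff)

lemma partial_coord: "partial i (\<lambda>z. z $ j) = (\<lambda>z. if i = j then 1 else 0)"
proof
  fix z :: "complex ^ 'a"
  have "((\<lambda>t. (z + axis i t) $ j) has_field_derivative (if i = j then 1 else 0)) (at 0)"
    by (cases "i = j") (auto simp: axis_def intro!: derivative_eq_intros)
  then show "partial i (\<lambda>z. z $ j) z = (if i = j then 1 else 0)"
    unfolding partial_def by (rule DERIV_imp_deriv)
qed

lemma partial_add:
  assumes "polynomial_in UNIV f" "polynomial_in UNIV g"
  shows "partial i (\<lambda>z. f z + g z) = (\<lambda>z. partial i f z + partial i g z)"
proof
  fix z
  show "partial i (\<lambda>z. f z + g z) z = partial i f z + partial i g z"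
    using DERIV_imp_deriv[OF DERIV_add[OF has_partial[OF assms(1), of z i] has_partial[OF assms(2), of z i]]]
    by (simp only: partial_def)
qed

lemma axis_zero: "axis i 0 = (0 :: 'a::zero ^ 'n)"
  by (simp add: axis_def vec_eq_iff)

lemma partial_mult:
  assumes "polynomial_in UNIV f" "polynomial_in UNIV g"
  shows "partial i (\<lambda>z. f z * g z) = (\<lambda>z. f z * partial i g z + partial i f z * g z)"
proof
  fix z
  show "partial i (\<lambda>z. f z * g z) z = f z * partial i g z + partial i f z * g z"
    using DERIV_imp_deriv[OF DERIV_mult'[OF has_partial[OF assms(1), of z i] has_partial[OF assms(2), of z i]]]
    by (simp only: partial_def axis_zero add_0_right)
qed

lemma polynomial_in_partial:
  "polynomial_in UNIV f \<Longrightarrow> polynomial_in UNIV (partial i f)"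
  by (induction rule: polynomial_in.induct)
     (auto simp: partial_const partial_coord partial_add partial_mult intro!: polynomial_in.intros)

lemma rank_outer_product_le_1:
  fixes m n :: "'n::finite \<Rightarrow> 'a::field"
  shows "rank ((\<chi> i j. m i * n j) :: 'a ^ 'n ^ 'n) \<le> 1"
proof -
  have "rows ((\<chi> i j. m i * n j) :: 'a ^ 'n ^ 'n) \<subseteq> vec.span {\<chi> j. n j}"
  proof
    fix r assume "r \<in> rows ((\<chi> i j. m i * n j) :: 'a ^ 'n ^ 'n)"
    then obtain i where "r = m i *s (\<chi> j. n j)"
      by (auto simp: rows_def row_def vec_eq_iff)
    then show "r \<in> vec.span {\<chi> j. n j}"
      by (simp add: vec.span_base vec.span_scale)
  qed
  then show ?thesis
    unfolding row_rank_def_gen using vec.dim_le_card[of _ "{\<chi> j. n j}"] by fastforce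
qed

text \<open>
  In the Hessian at \<open>p\<close> a product of three functions that vanish at \<open>p\<close> disappears, and \<open>h m\<^sup>2\<close>
  contributes the matrix \<open>2 h(p) \<partial>\<^sub>im \<partial>\<^sub>jm\<close>, whose rank is at most one.
\<close>

lemma not_node_if_tangent_cone_square:
  assumes poly: "polynomial_in UNIV h" "polynomial_in UNIV m" "polynomial_in UNIV Y" "polynomial_in UNIV Z"
      "polynomial_in UNIV W" "polynomial_in UNIV a" "polynomial_in UNIV b" "polynomial_in UNIV c"
    and zero: "m p = 0" "Y p = 0" "Z p = 0" "W p = 0" "a p = 0" "b p = 0" "c p = 0"
    and F: "F = (\<lambda>z. h z * (m z * m z) + Y z * Z z * a z + Y z * W z * b z + Z z * W z * c z)"
  shows "\<not> is_node F p"
proof -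
  have "partial i (partial j F) p = (2 * h p * partial i m p) * partial j m p" for i j
    unfolding F
    by (simp add: partial_add partial_mult poly zero polynomial_in_partial
          polynomial_in.const polynomial_in.add polynomial_in.mult)
  then have "(\<chi> i j. partial i (partial j F) p) = (\<chi> i j. (2 * h p * partial i m p) * partial j m p)"
    by simp
  then show ?thesis
    unfolding is_node_def
    using rank_outer_product_le_1[of "\<lambda>i. 2 * h p * partial i m p" "\<lambda>j. partial j m p"] by (simp only:) linarith
qed

text \<open>
  The preceding criterion for a vertex \<open>p\<close> of the tetrahedron of \<open>X\<close>, \<open>Y\<close>, \<open>Z\<close>, \<open>W\<close>, where
  \<open>X = 0\<close> is the opposite face.  The coefficients \<open>k\<^sub>1, \<dots>, k\<^sub>1\<^sub>2\<close>, \<open>e\<close> belong to the monomials of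
  degree at most one in \<open>X\<close> that occur when each face carries a square of mixed products.
\<close>

lemma not_node_at_vertex:
  assumes poly: "polynomial_in UNIV X" "polynomial_in UNIV Y" "polynomial_in UNIV Z" "polynomial_in UNIV W"
    and zero: "Y p = 0" "Z p = 0" "W p = 0"
    and square: "n11 = m1\<^sup>2" "n22 = m2\<^sup>2" "n33 = m3\<^sup>2" "n12 = m1 * m2" "n13 = m1 * m3" "n23 = m2 * m3"
    and F: "\<And>z. F z = (X z)\<^sup>2 * (n11 * (Y z)\<^sup>2 + n22 * (Z z)\<^sup>2 + n33 * (W z)\<^sup>2
         + 2 * (n12 * Y z * Z z + n13 * Y z * W z + n23 * Z z * W z))
       + Y z * Z z * (k1 * X z * Y z + k2 * X z * Z z + k3 * Y z * Z z + k4 * Y z * W z + k5 * Z z * W z + e * X z * W z)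
       + Y z * W z * (k6 * X z * Y z + k7 * X z * W z + k8 * Y z * W z + k9 * Z z * W z)
       + Z z * W z * (k10 * X z * Z z + k11 * X z * W z + k12 * Z z * W z)"
  shows "\<not> is_node F p"
proof -
  have sq: "n11 * y\<^sup>2 + n22 * z\<^sup>2 + n33 * w\<^sup>2 + 2 * (n12 * y * z + n13 * y * w + n23 * z * w)
      = (m1 * y + m2 * z + m3 * w) * (m1 * y + m2 * z + m3 * w)" for y z w
    unfolding square by algebra
  have "F = (\<lambda>z. (X z)\<^sup>2 * ((m1 * Y z + m2 * Z z + m3 * W z) * (m1 * Y z + m2 * Z z + m3 * W z))
       + Y z * Z z * (k1 * X z * Y z + k2 * X z * Z z + k3 * Y z * Z z + k4 * Y z * W z + k5 * Z z * W z + e * X z * W z)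
       + Y z * W z * (k6 * X z * Y z + k7 * X z * W z + k8 * Y z * W z + k9 * Z z * W z)
       + Z z * W z * (k10 * X z * Z z + k11 * X z * W z + k12 * Z z * W z))"
    by (rule ext) (simp only: F sq)
  then show ?thesis
    by (rule not_node_if_tangent_cone_square[rotated -1])
       (intro polynomial_in_intros poly | simp add: zero)+
qed

section \<open>Quartics that are determined by their restrictions to the coordinate planes\<close>

definition drop_coord :: "'n \<Rightarrow> complex ^ 'n \<Rightarrow> complex ^ 'n" where
  "drop_coord i Y = (\<chi> j. if j = i then 0 else Y $ j)"

lemma drop_coord_nth: "drop_coord i Y $ j = (if j = i then 0 else Y $ j)"
  by (simp add: drop_coord_def)

lemma polynomial_in_drop_coord:
  assumes "polynomial_in UNIV f"
  shows "polynomial_in UNIV (\<lambda>Y. f (drop_coord i Y))"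
proof (rule polynomial_in_compose[OF assms])
  show "polynomial_in UNIV (\<lambda>Y. drop_coord i Y $ j)" for j
    by (cases "j = i") (auto simp: drop_coord_nth intro: polynomial_in.intros)
qed

lemma polynomial_minus_restriction_divisible:
  assumes "polynomial_in UNIV f"
  obtains q where "polynomial_in UNIV q" "\<And>Y. f Y - f (drop_coord i Y) = Y $ i * q Y"
proof -
  have "\<exists>q. polynomial_in UNIV q \<and> (\<forall>Y. f Y - f (drop_coord i Y) = Y $ i * q Y)"
    using assms
  proof (induction rule: polynomial_in.induct)
    case (const c)
    show ?case by (rule exI[of _ "\<lambda>Y. 0"]) (auto intro: polynomial_in.intros)
  next
    case (coord j)
    show ?case
      by (rule exI[of _ "\<lambda>Y. if j = i then 1 else 0"]) (auto simp: drop_coord_nth intro: polynomial_in.intros)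
  next
    case (add f g)
    then obtain q r where qr: "polynomial_in UNIV q" "\<And>Y. f Y - f (drop_coord i Y) = Y $ i * q Y"
      "polynomial_in UNIV r" "\<And>Y. g Y - g (drop_coord i Y) = Y $ i * r Y" by blast
    have "f Y + g Y - (f (drop_coord i Y) + g (drop_coord i Y)) = Y $ i * (q Y + r Y)" for Y
      using qr(2)[of Y] qr(4)[of Y] by algebra
    then show ?case
      using polynomial_in.add[OF qr(1,3)] by blast
  next
    case (mult f g)
    then obtain q r where qr: "polynomial_in UNIV q" "\<And>Y. f Y - f (drop_coord i Y) = Y $ i * q Y"
      "polynomial_in UNIV r" "\<And>Y. g Y - g (drop_coord i Y) = Y $ i * r Y" by blast
    have "f Y * g Y - f (drop_coord i Y) * g (drop_coord i Y)
        = Y $ i * (f Y * r Y + q Y * g (drop_coord i Y))" for Y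
      using qr(2)[of Y] qr(4)[of Y] by algebra
    moreover have "polynomial_in UNIV (\<lambda>Y. f Y * r Y + q Y * g (drop_coord i Y))"
      by (intro polynomial_in.intros polynomial_in_drop_coord qr(1,3) mult.hyps)
    ultimately show ?case by blast
  qed
  then show ?thesis using that by blast
qed

text \<open>
  The cofactor \<open>q\<close> is homogeneous of degree zero where no coordinate vanishes, hence constant
  along the line through such a point and the origin, and so equal to its limit at the origin.
\<close>

lemma quartic_divisible_by_all_coords:
  assumes q: "polynomial_in UNIV q"
    and P: "\<And>Y. P Y = Y $ 0 * Y $ 1 * Y $ 2 * Y $ 3 * q (Y :: complex ^ 4)"
    and hom: "\<And>t Y. P (t *s Y) = t ^ 4 * P Y"
  shows "P Y = Y $ 0 * Y $ 1 * Y $ 2 * Y $ 3 * q 0"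
proof (cases "Y $ 0 * Y $ 1 * Y $ 2 * Y $ 3 = 0")
  case False
  have "q (t *s Y) = q Y" if "t \<noteq> 0" for t
  proof -
    have "(t ^ 4 * (Y $ 0 * Y $ 1 * Y $ 2 * Y $ 3)) * q (t *s Y) = (t ^ 4 * (Y $ 0 * Y $ 1 * Y $ 2 * Y $ 3)) * q Y"
      using hom[of t Y] unfolding P by (simp add: algebra_simps power_numeral_reduce)
    then show ?thesis using False that by simp
  qed
  then have "eventually (\<lambda>t. q (t *s Y) = q Y) (at 0)"
    by (auto simp: eventually_at intro: exI[of _ 1])
  then have "((\<lambda>t. q (t *s Y)) \<longlongrightarrow> q Y) (at 0)"
    by (rule tendsto_eventually)
  moreover have "((\<lambda>t. t *s Y) \<longlongrightarrow> 0) (at 0)"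
    by (rule vec_tendstoI) (auto intro!: tendsto_eq_intros)
  then have "((\<lambda>t. q (t *s Y)) \<longlongrightarrow> q 0) (at 0)"
    by (intro isCont_tendsto_compose[OF polynomial_in_continuous[OF q]])
  ultimately have "q Y = q 0"
    using tendsto_unique[OF trivial_limit_at] by blast
  then show ?thesis by (simp add: P)
qed (use P in simp)

text \<open>A point of \<open>\<complex>\<^sup>4\<close> in the indexing \<open>Y\<^sub>0, \<dots>, Y\<^sub>3\<close> of the Rosenhain quartic.\<close>

definition vec4 :: "complex \<Rightarrow> complex \<Rightarrow> complex \<Rightarrow> complex \<Rightarrow> complex ^ 4" where
  "vec4 a b c d = (\<chi> i. if i = 0 then a else if i = 1 then b else if i = 2 then c else d)"

lemma vec4_nth [simp]:
  "vec4 a b c d $ 0 = a" "vec4 a b c d $ 1 = b" "vec4 a b c d $ 2 = c" "vec4 a b c d $ 3 = d"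
  by (simp_all add: vec4_def)

lemma all_4_from_0: "(\<forall>i::4. P i) \<longleftrightarrow> P 0 \<and> P 1 \<and> P 2 \<and> P 3"
proof -
  have "(4::4) = 0" by simp
  then show ?thesis unfolding forall_4 by metis
qed

lemma vec4_eqI: "x $ 0 = y $ 0 \<Longrightarrow> x $ 1 = y $ 1 \<Longrightarrow> x $ 2 = y $ 2 \<Longrightarrow> x $ 3 = y $ 3 \<Longrightarrow> x = (y :: complex ^ 4)"
  by (simp add: vec_eq_iff all_4_from_0)

lemma drop_coord_vec4:
  "drop_coord 0 (vec4 a b c d) = vec4 0 b c d" "drop_coord 1 (vec4 a b c d) = vec4 a 0 c d"
  "drop_coord 2 (vec4 a b c d) = vec4 a b 0 d" "drop_coord 3 (vec4 a b c d) = vec4 a b c 0"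
  by (auto intro!: vec4_eqI simp: drop_coord_nth)

lemma drop_coord_scale: "drop_coord i (t *s Y) = t *s drop_coord i Y"
  by (simp add: vec_eq_iff drop_coord_nth)

text \<open>
  Write \<open>\<rho>\<^sub>i\<close> for putting the \<open>i\<close>-th coordinate to zero.  Expanding
  \<open>(1 - \<rho>\<^sub>3) (1 - \<rho>\<^sub>2) (1 - \<rho>\<^sub>1) (1 - \<rho>\<^sub>0) G\<close> gives the alternating sum of the restrictions, and each
  factor \<open>1 - \<rho>\<^sub>i\<close> splits off a factor \<open>Y\<^sub>i\<close>.
\<close>

lemma quartic_determined_by_faces:
  assumes poly: "polynomial_in UNIV G"
    and hom: "\<And>t Y. G (t *s Y) = t ^ 4 * G (Y :: complex ^ 4)"
  obtains e where "\<And>a b c d. G (vec4 a b c d) =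
      G (vec4 0 b c d) + G (vec4 a 0 c d) + G (vec4 a b 0 d) + G (vec4 a b c 0)
      - G (vec4 a b 0 0) - G (vec4 a 0 c 0) - G (vec4 a 0 0 d) - G (vec4 0 b c 0) - G (vec4 0 b 0 d) - G (vec4 0 0 c d)
      + G (vec4 a 0 0 0) + G (vec4 0 b 0 0) + G (vec4 0 0 c 0) + G (vec4 0 0 0 d) + e * a * b * c * d"
proof -
  define P where "P = (\<lambda>(i :: 4) (f :: complex ^ 4 \<Rightarrow> complex) Y. f Y - f (drop_coord i Y))"
  have P_hom: "P i f (t *s Y) = t ^ 4 * P i f Y" if "\<And>t Y. f (t *s Y) = t ^ 4 * f (Y :: complex ^ 4)" for i f t Y
    by (simp add: P_def drop_coord_scale that algebra_simps)
  have step: "\<exists>q. polynomial_in UNIV q \<and> (\<forall>Y. P i (\<lambda>Y. m Y * f Y) Y = m Y * (Y $ i * q Y))"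
    if f: "polynomial_in UNIV f" and m: "\<And>Y. m (drop_coord i Y) = m Y" for i m and f :: "complex ^ 4 \<Rightarrow> complex"
  proof -
    obtain q where "polynomial_in UNIV q" and q: "\<And>Y. f Y - f (drop_coord i Y) = Y $ i * q Y"
      using polynomial_minus_restriction_divisible[OF f, of i] by blast
    moreover have "P i (\<lambda>Y. m Y * f Y) Y = m Y * (Y $ i * q Y)" for Y
      using q[of Y] by (simp add: P_def m flip: right_diff_distrib)
    ultimately show ?thesis by blast
  qed
  \<comment> \<open>The factors already split off do not contain the next coordinate, so they pass through \<open>P i\<close>.\<close>
  obtain q0 where q0: "polynomial_in UNIV q0" "P 0 G = (\<lambda>Y. Y $ 0 * q0 Y)"
    using step[OF poly, of "\<lambda>_. 1" 0] by auto
  obtain q1 where q1: "polynomial_in UNIV q1" "P 1 (P 0 G) = (\<lambda>Y. Y $ 0 * (Y $ 1 * q1 Y))"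
    using step[OF q0(1), of "\<lambda>Y. Y $ 0" 1] by (auto simp: q0(2) drop_coord_nth)
  obtain q2 where q2: "polynomial_in UNIV q2" "P 2 (P 1 (P 0 G)) = (\<lambda>Y. Y $ 0 * Y $ 1 * (Y $ 2 * q2 Y))"
    using step[OF q1(1), of "\<lambda>Y. Y $ 0 * Y $ 1" 2] by (auto simp: q1(2) drop_coord_nth mult.assoc)
  obtain q3 where q3: "polynomial_in UNIV q3"
      "P 3 (P 2 (P 1 (P 0 G))) = (\<lambda>Y. Y $ 0 * Y $ 1 * Y $ 2 * (Y $ 3 * q3 Y))"
    using step[OF q2(1), of "\<lambda>Y. Y $ 0 * Y $ 1 * Y $ 2" 3] by (auto simp: q2(2) drop_coord_nth mult.assoc)
  have R: "P 3 (P 2 (P 1 (P 0 G))) Y = Y $ 0 * Y $ 1 * Y $ 2 * Y $ 3 * q3 0" for Y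
  proof (rule quartic_divisible_by_all_coords[OF q3(1)])
    show "P 3 (P 2 (P 1 (P 0 G))) Y = Y $ 0 * Y $ 1 * Y $ 2 * Y $ 3 * q3 Y" for Y
      by (simp add: q3(2) mult.assoc)
    show "P 3 (P 2 (P 1 (P 0 G))) (t *s Y) = t ^ 4 * P 3 (P 2 (P 1 (P 0 G))) Y" for t Y
      by (intro P_hom hom)
  qed
  have "G (vec4 0 0 0 0) = 0"
  proof -
    have "vec4 0 0 0 0 = 0" by (rule vec4_eqI) simp_all
    then show ?thesis using hom[of 0 0] by simp
  qed
  then have "G (vec4 a b c d) =
      G (vec4 0 b c d) + G (vec4 a 0 c d) + G (vec4 a b 0 d) + G (vec4 a b c 0)
      - G (vec4 a b 0 0) - G (vec4 a 0 c 0) - G (vec4 a 0 0 d) - G (vec4 0 b c 0) - G (vec4 0 b 0 d) - G (vec4 0 0 c d)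
      + G (vec4 a 0 0 0) + G (vec4 0 b 0 0) + G (vec4 0 0 c 0) + G (vec4 0 0 0 d) + q3 0 * a * b * c * d" for a b c d
  proof -
    have "P 3 (P 2 (P 1 (P 0 G))) (vec4 a b c d) =
        G (vec4 a b c d)
        - (G (vec4 0 b c d) + G (vec4 a 0 c d) + G (vec4 a b 0 d) + G (vec4 a b c 0))
        + (G (vec4 a b 0 0) + G (vec4 a 0 c 0) + G (vec4 a 0 0 d) + G (vec4 0 b c 0) + G (vec4 0 b 0 d) + G (vec4 0 0 c d))
        - (G (vec4 a 0 0 0) + G (vec4 0 b 0 0) + G (vec4 0 0 c 0) + G (vec4 0 0 0 d)) + G (vec4 0 0 0 0)"
      unfolding P_def drop_coord_vec4 by simp
    then show ?thesis
      using R[of "vec4 a b c d"] \<open>G (vec4 0 0 0 0) = 0\<close> unfolding vec4_nth by algebra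
  qed
  then show ?thesis using that by blast
qed

section \<open>Quadratic forms and planes on which a function is a square\<close>

inductive quadratic_form :: "(complex ^ 'n \<Rightarrow> complex) \<Rightarrow> bool" where
  quadratic_coords: "quadratic_form (\<lambda>z. z $ i * z $ j)"
| quadratic_add: "quadratic_form f \<Longrightarrow> quadratic_form g \<Longrightarrow> quadratic_form (\<lambda>z. f z + g z)"
| quadratic_scale: "quadratic_form f \<Longrightarrow> quadratic_form (\<lambda>z. c * f z)"

lemma quadratic_form_expand:
  assumes "quadratic_form Q"
  shows "Q (r *s u + s *s v + t *s w) =
    r\<^sup>2 * Q u + s\<^sup>2 * Q v + t\<^sup>2 * Q w + r * s * (Q (u + v) - Q u - Q v)
     + r * t * (Q (u + w) - Q u - Q w) + s * t * (Q (v + w) - Q v - Q w)"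
  using assms
proof (induction rule: quadratic_form.induct)
  case (quadratic_coords i j)
  show ?case by (simp add: algebra_simps power2_eq_square)
next
  case (quadratic_add f g)
  show ?case by (simp only: quadratic_add.IH) (simp add: algebra_simps)
next
  case (quadratic_scale f c)
  show ?case by (simp only: quadratic_scale.IH) (simp add: algebra_simps)
qed

lemma quadratic_form_spanned_by_zeros:
  assumes Q: "quadratic_form Q" and zeros: "(Q u)\<^sup>2 = 0" "(Q v)\<^sup>2 = 0" "(Q w)\<^sup>2 = 0"
  obtains a b c where "\<And>r s t. Q (r *s u + s *s v + t *s w) = a * r * s + b * r * t + c * s * t"
proof
  show "Q (r *s u + s *s v + t *s w) = Q (u + v) * r * s + Q (u + w) * r * t + Q (v + w) * s * t" for r s t
    using zeros by (simp add: quadratic_form_expand[OF Q])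
qed

definition square_on :: "(complex ^ 'n \<Rightarrow> complex) \<Rightarrow> (complex ^ 'n) set \<Rightarrow> bool" where
  "square_on F H \<longleftrightarrow> (\<exists>Q. quadratic_form Q \<and> (\<forall>z\<in>H. F z = (Q z)\<^sup>2))"

lemma square_onI:
  assumes "quadratic_form Q" "\<And>z. z \<in> H \<Longrightarrow> F z = (Q z)\<^sup>2"
  shows "square_on F H"
  using assms unfolding square_on_def by blast

text \<open>
  Three points of the surface \<open>F = 0\<close> are zeros of the quadratic form, so that only mixed
  products remain in the plane that they span.
\<close>

lemma square_on_triangle:
  assumes sq: "square_on F H" and H: "\<And>r s t. r *s u + s *s v + t *s w \<in> H"
    and zeros: "F u = 0" "F v = 0" "F w = 0"
  obtains a b c where "\<And>r s t. F (r *s u + s *s v + t *s w) = (a * r * s + b * r * t + c * s * t)\<^sup>2"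
proof -
  obtain Q where Q: "quadratic_form Q" and F: "\<And>z. z \<in> H \<Longrightarrow> F z = (Q z)\<^sup>2"
    using sq unfolding square_on_def by blast
  have "u \<in> H" "v \<in> H" "w \<in> H"
    using H[of 1 0 0] H[of 0 1 0] H[of 0 0 1] by simp_all
  then have "(Q u)\<^sup>2 = 0" "(Q v)\<^sup>2 = 0" "(Q w)\<^sup>2 = 0"
    using zeros F by auto
  then obtain a b c where "\<And>r s t. Q (r *s u + s *s v + t *s w) = a * r * s + b * r * t + c * s * t"
    using quadratic_form_spanned_by_zeros[OF Q] by blast
  then have "F (r *s u + s *s v + t *s w) = (a * r * s + b * r * t + c * s * t)\<^sup>2" for r s t
    using F[OF H] by simp
  then show ?thesis using that by blast
qed

section \<open>The equation of the Cassels--Flynn quartic\<close>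

text \<open>
  The constant coefficient and the equation of the Kummer quartic of
  \<open>y\<^sup>2 = x\<^sup>5 + f\<^sub>4x\<^sup>4 + f\<^sub>3x\<^sup>3 + f\<^sub>2x\<^sup>2 + f\<^sub>1x + f\<^sub>0\<close> in the form of Cassels and Flynn.  Keeping the quintic
  general lets all five finite branch points be treated alike.
\<close>

definition flynn_K0 ::
  "complex \<Rightarrow> complex \<Rightarrow> complex \<Rightarrow> complex \<Rightarrow> complex \<Rightarrow> complex ^ 4 \<Rightarrow> complex" where
  "flynn_K0 f0 f1 f2 f3 f4 z =
     (let x = z $ 1; y = z $ 2; t = z $ 3 in
      (f1\<^sup>2 - 4 * f0 * f2) * x^4 - 4 * f0 * f3 * x^3 * y - 2 * f1 * f3 * x^3 * t - 4 * f0 * f4 * x\<^sup>2 * y\<^sup>2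
      + 4 * (f0 - f1 * f4) * x\<^sup>2 * y * t + (f3\<^sup>2 + 2 * f1 - 4 * f2 * f4) * x\<^sup>2 * t\<^sup>2
      - 4 * f0 * x * y^3 - 4 * f1 * x * y\<^sup>2 * t - 4 * f2 * x * y * t\<^sup>2 - 2 * f3 * x * t^3 + t^4)"

definition flynn ::
  "complex \<Rightarrow> complex \<Rightarrow> complex \<Rightarrow> complex \<Rightarrow> complex \<Rightarrow> complex ^ 4 \<Rightarrow> complex" where
  "flynn f0 f1 f2 f3 f4 z =
     (let x = z $ 1; y = z $ 2; t = z $ 3; w = z $ 4 in
      (y\<^sup>2 - 4 * x * t) * w\<^sup>2
      - 2 * (2 * f0 * x^3 + f1 * x\<^sup>2 * y + 2 * f2 * x\<^sup>2 * t + f3 * x * y * t + 2 * f4 * x * t\<^sup>2 + y * t\<^sup>2) * w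
      + flynn_K0 f0 f1 f2 f3 f4 z)"

lemma polynomial_in_flynn_K0:
  assumes "{1, 2, 3} \<subseteq> I"
  shows "polynomial_in I (flynn_K0 f0 f1 f2 f3 f4)"
  using assms unfolding flynn_K0_def[abs_def] Let_def
  by (intro polynomial_in_intros; simp)

lemma polynomial_in_flynn: "polynomial_in UNIV (flynn f0 f1 f2 f3 f4)"
  unfolding flynn_def[abs_def] Let_def
  by (intro polynomial_in_intros polynomial_in_flynn_K0; simp)

lemma flynn_homogeneous: "flynn f0 f1 f2 f3 f4 (t *s z) = t ^ 4 * flynn f0 f1 f2 f3 f4 z"
  unfolding flynn_def flynn_K0_def Let_def vector_smult_component by algebra

text \<open>
  On the line through \<open>z\<close> in the second coordinate direction, \<open>K\<^sub>2\<close> is a quadratic polynomial with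
  leading coefficient one.
\<close>

lemma cf_K2_nonzero_nearby: "eventually (\<lambda>t. cf_K2 (z + axis 2 t) \<noteq> 0) (at 0)"
proof -
  let ?p = "[: cf_K2 z, 2 * z $ 2, 1 :]"
  have K: "cf_K2 (z + axis 2 t) = poly ?p t" for t
    by (simp add: cf_K2_def axis_def power2_eq_square algebra_simps)
  have "finite {t. poly ?p t = 0}"
    by (rule poly_roots_finite) simp
  then have "eventually (\<lambda>t. t \<notin> {t. poly ?p t = 0}) (at 0)"
    by (metis islimpt_finite islimpt_iff_eventually)
  then show ?thesis by (simp add: K)
qed

text \<open>
  Two candidates for \<open>K\<^sub>0\<close> agree where \<open>K\<^sub>2\<close> does not vanish, and by continuity everywhere.
\<close>

lemma cf_K0_unique:
  assumes f: "polynomial_in I f" and g: "polynomial_in I g"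
    and eq: "\<And>z. f z * cf_K2 z = g z * cf_K2 z"
  shows "f = g"
proof
  fix z
  let ?h = "\<lambda>t. f (z + axis 2 t) - g (z + axis 2 t)"
  have "((\<lambda>t. (z + axis 2 t) $ i) \<longlongrightarrow> z $ i) (at 0)" for i
    by (cases "i = 2") (auto simp: axis_def intro!: tendsto_eq_intros)
  then have ax: "((\<lambda>t. z + axis 2 t) \<longlongrightarrow> z) (at 0)"
    by (rule vec_tendstoI)
  have "(?h \<longlongrightarrow> f z - g z) (at 0)"
    by (intro tendsto_diff isCont_tendsto_compose[OF _ ax] polynomial_in_continuous[OF f] polynomial_in_continuous[OF g])
  moreover have "eventually (\<lambda>t. ?h t = 0) (at 0)"
    using cf_K2_nonzero_nearby[of z] by eventually_elim (use eq in auto)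
  then have "(?h \<longlongrightarrow> 0) (at 0)" by (rule tendsto_eventually)
  ultimately show "f z = g z"
    using tendsto_unique[OF trivial_limit_at] by fastforce
qed

text \<open>
  For the quintic \<open>x (x - 1) (x - \<lambda>\<^sub>1) (x - \<lambda>\<^sub>2) (x - \<lambda>\<^sub>3)\<close> the form \<open>flynn_K0\<close> satisfies the equation
  that defines \<open>K\<^sub>0\<close>.
\<close>

lemma cassels_flynn_eq_flynn:
  "cassels_flynn l1 l2 l3 =
   flynn 0 (l1*l2*l3) (- (l1*l2*l3 + l1*l2 + l1*l3 + l2*l3))
     (l1*l2 + l1*l3 + l2*l3 + l1+l2+l3) (- (1+l1+l2+l3))"
proof -
  let ?K = "flynn_K0 0 (l1*l2*l3) (- (l1*l2*l3 + l1*l2 + l1*l3 + l2*l3))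
    (l1*l2 + l1*l3 + l2*l3 + l1+l2+l3) (- (1+l1+l2+l3))"
  have i: "{1..6::nat} = {1,2,3,4,5,6}" by auto
  have K: "(cf_K1 l1 l2 l3 z)\<^sup>2 - 4 * ?K z * cf_K2 z = 16 * (\<Prod>i\<in>{1..6}. trope_form l1 l2 l3 i z)" for z
    unfolding i by (simp add: trope_form_def lam_def flynn_K0_def cf_K1_def cf_K2_def Let_def) algebra
  have K0: "cf_K0 l1 l2 l3 = ?K"
    unfolding cf_K0_def
  proof (rule the_equality)
    show "polynomial_in {1,2,3} ?K \<and> (\<forall>z. (cf_K1 l1 l2 l3 z)\<^sup>2 - 4 * ?K z * cf_K2 z
               = 16 * (\<Prod>i\<in>{1..6}. trope_form l1 l2 l3 i z))"
      using K polynomial_in_flynn_K0[OF subset_refl] by blast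
  next
    fix f assume f: "polynomial_in {1,2,3} f \<and> (\<forall>z. (cf_K1 l1 l2 l3 z)\<^sup>2 - 4 * f z * cf_K2 z
               = 16 * (\<Prod>i\<in>{1..6}. trope_form l1 l2 l3 i z))"
    have cancel: "x * k = y * k" if "a - 4 * x * k = c" "a - 4 * y * k = c" for a c x y k :: complex
      using that by auto
    have "f z * cf_K2 z = ?K z * cf_K2 z" for z
      using cancel[OF conjunct2[OF f, rule_format] K] .
    then show "f = ?K"
      using f polynomial_in_flynn_K0[OF subset_refl] cf_K0_unique by metis
  qed
  have "cassels_flynn l1 l2 l3 z = flynn 0 (l1*l2*l3) (- (l1*l2*l3 + l1*l2 + l1*l3 + l2*l3))
      (l1*l2 + l1*l3 + l2*l3 + l1+l2+l3) (- (1+l1+l2+l3)) z" for z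
    unfolding cassels_flynn_def K0 flynn_def flynn_K0_def cf_K1_def cf_K2_def Let_def by algebra
  then show ?thesis by (rule ext)
qed

section \<open>Every trope touches the quartic along a conic\<close>

text \<open>
  On the plane of a root \<open>a\<close> of the quintic, \<open>K\<^sub>2\<close> becomes \<open>(z\<^sub>2 - 2 a z\<^sub>1)\<^sup>2\<close>, and the discriminant
  \<open>K\<^sub>1\<^sup>2 - 4 K\<^sub>0 K\<^sub>2\<close> in \<open>z\<^sub>4\<close> vanishes.  So the quartic is the square of
  \<open>(z\<^sub>2 - 2 a z\<^sub>1) z\<^sub>4 + K\<^sub>1 / (2 (z\<^sub>2 - 2 a z\<^sub>1))\<close>, and the division is exact.
\<close>

lemma flynn_square_on_root_trope:
  assumes root: "f0 + f1 * a + f2 * a^2 + f3 * a^3 + f4 * a^4 + a^5 = 0"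
  shows "square_on (flynn f0 f1 f2 f3 f4) {z. a\<^sup>2 * z $ 1 - a * z $ 2 + z $ 3 = 0}"
proof (rule square_onI)
  let ?Q = "\<lambda>z::complex^4. z $ 2 * z $ 4 + (- 2 * a) * (z $ 1 * z $ 4) + (- a\<^sup>2) * (z $ 2 * z $ 2)
     + (- a * f3 - 2 * a\<^sup>2 * f4) * (z $ 1 * z $ 2) + (- f1 - 2 * a * f2 - a\<^sup>2 * f3 - a^4) * (z $ 1 * z $ 1)"
  show "quadratic_form ?Q"
    by (intro quadratic_add quadratic_scale quadratic_coords)
  fix z :: "complex ^ 4" assume "z \<in> {z. a\<^sup>2 * z $ 1 - a * z $ 2 + z $ 3 = 0}"
  then have z3: "z $ 3 = a * z $ 2 - a\<^sup>2 * z $ 1" by (simp add: algebra_simps)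
  have f0: "f0 = - (f1 * a + f2 * a^2 + f3 * a^3 + f4 * a^4 + a^5)" using root by algebra
  show "flynn f0 f1 f2 f3 f4 z = (?Q z)\<^sup>2"
    unfolding flynn_def flynn_K0_def Let_def z3 f0 by algebra
qed

text \<open>
  The trope of the branch point at infinity, where \<open>K\<^sub>2 = z\<^sub>2\<^sup>2\<close>, \<open>K\<^sub>1 = - 2 z\<^sub>2 z\<^sub>3\<^sup>2\<close> and \<open>K\<^sub>0 = z\<^sub>3\<^sup>4\<close>.
\<close>

lemma flynn_square_on_infinite_trope:
  "square_on (flynn f0 f1 f2 f3 f4) {z. z $ 1 = 0}"
proof (rule square_onI)
  let ?Q = "\<lambda>z::complex^4. z $ 2 * z $ 4 + (- 1) * (z $ 3 * z $ 3)"
  show "quadratic_form ?Q"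
    by (intro quadratic_add quadratic_scale quadratic_coords)
  fix z :: "complex ^ 4" assume "z \<in> {z. z $ 1 = 0}"
  then have z1: "z $ 1 = 0" by simp
  have "flynn f0 f1 f2 f3 f4 z = (z $ 2)\<^sup>2 * (z $ 4)\<^sup>2 - 2 * (z $ 2 * (z $ 3)\<^sup>2) * z $ 4 + (z $ 3) ^ 4"
    by (simp add: flynn_def flynn_K0_def z1 Let_def)
  also have "\<dots> = (?Q z)\<^sup>2" by algebra
  finally show "flynn f0 f1 f2 f3 f4 z = (?Q z)\<^sup>2" .
qed

text \<open>
  The hypotheses on \<open>f\<^sub>0, \<dots>, f\<^sub>4\<close> factor the quintic as
  \<open>(x\<^sup>2 - u x + v) (x\<^sup>3 - e\<^sub>1x\<^sup>2 + e\<^sub>2x - e\<^sub>3)\<close>, so one computation covers all ten splittings of the finite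
  branch points into a pair and a triple.  The form \<open>Q\<close> extends \<open>z\<^sub>3\<^sup>2 - u z\<^sub>2z\<^sub>3 + v z\<^sub>2\<^sup>2\<close>, its
  restriction to \<open>z\<^sub>1 = 0\<close>; its other coefficients come from comparing powers of \<open>z\<^sub>1\<close>.
\<close>

lemma flynn_square_on_pair_trope:
  assumes f: "f0 = - (v * e3)" "f1 = v * e2 + u * e3" "f2 = - (e3 + u * e2 + v * e1)"
    "f3 = e2 + u * e1 + v" "f4 = - (u + e1)"
  shows "square_on (flynn f0 f1 f2 f3 f4) {z. z $ 4 - u * z $ 3 + v * z $ 2 - (v * e1 + e3) * z $ 1 = 0}"
proof (rule square_onI)
  let ?Q = "\<lambda>z::complex^4. z $ 3 * z $ 3 + (- u) * (z $ 2 * z $ 3) + v * (z $ 2 * z $ 2)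
    + (u * e1 - e2 - v) * (z $ 1 * z $ 3) + (e3 - v * e1) * (z $ 1 * z $ 2) + (v * e2 - u * e3) * (z $ 1 * z $ 1)"
  show "quadratic_form ?Q"
    by (intro quadratic_add quadratic_scale quadratic_coords)
  fix z :: "complex ^ 4" assume "z \<in> {z. z $ 4 - u * z $ 3 + v * z $ 2 - (v * e1 + e3) * z $ 1 = 0}"
  then have z4: "z $ 4 = u * z $ 3 - v * z $ 2 + (v * e1 + e3) * z $ 1" by (simp add: algebra_simps)
  show "flynn f0 f1 f2 f3 f4 z = (?Q z)\<^sup>2"
    unfolding flynn_def flynn_K0_def Let_def z4 f by algebra
qed

lemma cassels_flynn_square_on_trope:
  assumes "H \<in> tropes l1 l2 l3"
  shows "square_on (cassels_flynn l1 l2 l3) H"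
proof -
  consider i where "i \<in> {1..6}" "H = {z. trope_form l1 l2 l3 i z = 0}"
    | i j where "1 \<le> i" "i < j" "j \<le> 5" "H = {z. trope_form6 l1 l2 l3 i j z = 0}"
    using assms unfolding tropes_def by auto
  then show ?thesis
  proof cases
    case 1
    show ?thesis
    proof (cases "i = 6")
      case True
      then show ?thesis using 1(2) unfolding cassels_flynn_eq_flynn
        by (simp add: trope_form_def flynn_square_on_infinite_trope)
    next
      case False
      with 1 have "lam l1 l2 l3 i \<in> {l1, l2, l3, 0, 1}" by (auto simp: lam_def)
      moreover have "H = {z. (lam l1 l2 l3 i)\<^sup>2 * z $ 1 - lam l1 l2 l3 i * z $ 2 + z $ 3 = 0}"
        using 1 False by (simp add: trope_form_def)
      moreover have "0 + (l1*l2*l3) * a + (- (l1*l2*l3 + l1*l2 + l1*l3 + l2*l3)) * a^2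
           + (l1*l2 + l1*l3 + l2*l3 + l1+l2+l3) * a^3 + (- (1+l1+l2+l3)) * a^4 + a^5 = 0"
        if "a \<in> {l1, l2, l3, 0, 1}" for a
      proof -
        have "(a - l1) * (a - l2) * (a - l3) * a * (a - 1) = 0" using that by auto
        then show ?thesis by algebra
      qed
      ultimately show ?thesis unfolding cassels_flynn_eq_flynn
        using flynn_square_on_root_trope by blast
    qed
  next
    case 2
    define R where "R = {1..5::nat} - {i, j}"
    define L where "L = lam l1 l2 l3"
    define e1 where "e1 = (\<Sum>k\<in>R. L k)"
    define e3 where "e3 = (\<Prod>k\<in>R. L k)"
    \<comment> \<open>The second elementary symmetric function of the \<open>L k\<close> with \<open>k \<in> R\<close>, obtained from that of
      \<open>l1\<close>, \<open>l2\<close>, \<open>l3\<close>, 0, 1.\<close>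
    define e2 where "e2 = l1*l2 + l1*l3 + l2*l3 + l1 + l2 + l3 - (L i + L j) * e1 - L i * L j"
    have H: "H = {z. z $ 4 - (L i + L j) * z $ 3 + L i * L j * z $ 2 - (L i * L j * e1 + e3) * z $ 1 = 0}"
      unfolding 2 trope_form6_def Let_def L_def e1_def e3_def R_def ..
    have r: "{1..5::nat} = {1,2,3,4,5}" by auto
    have "(i, j) \<in> {(1,2),(1,3),(1,4),(1,5),(2,3),(2,4),(2,5),(3,4),(3,5),(4,5)}"
      using \<open>1 \<le> i\<close> \<open>i < j\<close> \<open>j \<le> 5\<close> unfolding insert_iff prod.inject empty_iff by presburger
    then have "- (l1*l2*l3 + l1*l2 + l1*l3 + l2*l3) = - (e3 + (L i + L j) * e2 + L i * L j * e1)
        \<and> 1 + l1 + l2 + l3 = L i + L j + e1 \<and> 0 = L i * L j * e3 \<and> l1*l2*l3 = L i * L j * e2 + (L i + L j) * e3"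
      unfolding e1_def e3_def e2_def R_def r L_def
      by (elim insertE emptyE; auto simp: lam_def insert_Diff_if algebra_simps)
    then show ?thesis unfolding H cassels_flynn_eq_flynn
      by (intro flynn_square_on_pair_trope[where ?e2.0 = e2]) (auto simp: e2_def)
  qed
qed

section \<open>The normal form with respect to a tetrahedron\<close>

text \<open>
  A quadratic form on a face is known only through its square, so its sign can be chosen such
  that one coefficient gets a prescribed square root.
\<close>

lemma square_root_with_leading_coeff:
  fixes x y z p :: complex
  assumes "p\<^sup>2 = x\<^sup>2"
  obtains s where "\<And>u v w. (x * u + y * v + z * w)\<^sup>2 = (p * u + (s * y) * v + (s * z) * w)\<^sup>2"
proof -
  have "p = x \<or> p = - x" using assms by (simp add: power2_eq_iff)
  then show ?thesis
  proof
    assume "p = x" then show ?thesis using that[of 1] by simp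
  next
    assume "p = - x"
    moreover have "(x * u + y * v + z * w)\<^sup>2 = (- x * u + (- 1 * y) * v + (- 1 * z) * w)\<^sup>2" for u v w
      by algebra
    ultimately show ?thesis using that[of "-1"] by simp
  qed
qed

text \<open>
  The sum of the squares on the four faces counts each edge twice, hence the subtraction.  For
  \<open>p01 = p23\<close>, \<open>p02 = p13\<close>, \<open>p03 = p12\<close> this is a Rosenhain quartic.
\<close>

definition tetrahedral_quartic where
  "tetrahedral_quartic p01 p02 p03 p12 p13 p23 e a b c d =
    (p01 * a * b + p02 * a * c - p12 * b * c)\<^sup>2 + (p01 * a * b + p13 * b * d - p03 * a * d)\<^sup>2
    + (p23 * c * d - p02 * a * c - p03 * a * d)\<^sup>2 + (p23 * c * d - p13 * b * d - p12 * b * c)\<^sup>2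
    - (p01 * a * b)\<^sup>2 - (p02 * a * c)\<^sup>2 - (p03 * a * d)\<^sup>2 - (p12 * b * c)\<^sup>2 - (p13 * b * d)\<^sup>2 - (p23 * c * d)\<^sup>2
    + e * a * b * c * (d :: complex)"

text \<open>
  By a choice of signs for the four quadratic forms, the coefficients on the two faces through
  each of the edges \<open>01\<close>, \<open>02\<close> and \<open>23\<close> match as in \<open>tetrahedral_quartic\<close>.  On the edges \<open>03\<close>,
  \<open>13\<close> and \<open>12\<close> a sign remains open; the nodes at the vertices 0, 3 and 2, respectively, exclude
  the wrong one.  Each edge contains one of these three nodes, and so no coefficient vanishes.
\<close>

lemma tetrahedral_normal_form:
  fixes A B :: "complex ^ 4 ^ 4"
  assumes AB: "A ** B = mat 1" "B ** A = mat 1"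
    and poly: "polynomial_in UNIV F" and hom: "\<And>t z. F (t *s z) = t ^ 4 * F z"
    and faces: "\<And>i. square_on F {z. (A *v z) $ i = 0}"
    and nodes: "\<And>i. is_node F (B *v axis i 1)"
  obtains p01 p02 p03 p12 p13 p23 e where
    "p01 \<noteq> 0" "p02 \<noteq> 0" "p03 \<noteq> 0" "p12 \<noteq> 0" "p13 \<noteq> 0" "p23 \<noteq> 0"
    "\<And>z. F z = tetrahedral_quartic p01 p02 p03 p12 p13 p23 e
              ((A *v z) $ 0) ((A *v z) $ 1) ((A *v z) $ 2) ((A *v z) $ 3)"
proof -
  define v where "v = (\<lambda>i. B *v axis i 1)"
  define g where "g = (\<lambda>a b c d. F (B *v vec4 a b c d))"
  have Av: "A *v v i = axis i 1" for i
    by (simp add: v_def matrix_vector_mul_assoc AB)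
  have Fv: "F (v i) = 0" for i
    using nodes[of i] by (simp add: is_node_def v_def)
  have coords: "vec4 a b c d = a *s axis 0 1 + b *s axis 1 1 + c *s axis 2 1 + d *s axis 3 1" for a b c d
    by (rule vec4_eqI) (simp_all add: axis_def)
  have g: "g a b c d = F (a *s v 0 + b *s v 1 + c *s v 2 + d *s v 3)" for a b c d
    by (simp add: g_def coords v_def matrix_vector_right_distrib vector_scalar_commute)
  have Fg: "F z = g ((A *v z) $ 0) ((A *v z) $ 1) ((A *v z) $ 2) ((A *v z) $ 3)" for z
  proof -
    have "vec4 ((A *v z) $ 0) ((A *v z) $ 1) ((A *v z) $ 2) ((A *v z) $ 3) = A *v z"
      by (rule vec4_eqI) simp_all
    then show ?thesis by (simp add: g_def matrix_vector_mul_assoc AB)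
  qed

  have face: "\<exists>x y w. \<forall>r s t. F (r *s v i + s *s v j + t *s v k) = (x * r * s + y * r * t + w * s * t)\<^sup>2"
    if "i \<noteq> l" "j \<noteq> l" "k \<noteq> l" for i j k l
  proof -
    have "r *s v i + s *s v j + t *s v k \<in> {z. (A *v z) $ l = 0}" for r s t
      using that by (simp add: matrix_vector_right_distrib vector_scalar_commute Av axis_def)
    from square_on_triangle[OF faces this Fv Fv Fv] show ?thesis by metis
  qed
  obtain x01 x02 x12 where f3: "\<And>a b c. g a b c 0 = (x01 * a * b + x02 * a * c + x12 * b * c)\<^sup>2"
    using face[of 0 3 1 2] by (auto simp: g)
  obtain y01 y03 y13 where f2: "\<And>a b d. g a b 0 d = (y01 * a * b + y03 * a * d + y13 * b * d)\<^sup>2"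
    using face[of 0 2 1 3] by (auto simp: g)
  obtain u02 u03 u23 where f1: "\<And>a c d. g a 0 c d = (u02 * a * c + u03 * a * d + u23 * c * d)\<^sup>2"
    using face[of 0 1 2 3] by (auto simp: g)
  obtain w12 w13 w23 where f0: "\<And>b c d. g 0 b c d = (w12 * b * c + w13 * b * d + w23 * c * d)\<^sup>2"
    using face[of 1 0 2 3] by (auto simp: g)

  \<comment> \<open>The minus signs in the four squares below are those of the Rosenhain quartic.\<close>
  define p01 p02 p12 where "p01 = x01" and "p02 = x02" and "p12 = - x12"
  have g3: "g a b c 0 = (p01 * a * b + p02 * a * c - p12 * b * c)\<^sup>2" for a b c
    by (simp add: f3 p01_def p02_def p12_def)

  have "p01\<^sup>2 = y01\<^sup>2" using f2[of 1 1 0] g3[of 1 1 0] by simp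
  then obtain s2 where s2: "\<And>a b c. (y01 * a + y03 * b + y13 * c)\<^sup>2 = (p01 * a + (s2 * y03) * b + (s2 * y13) * c)\<^sup>2"
    using square_root_with_leading_coeff[of p01 y01 y03 y13] by blast
  define p03 p13 where "p03 = - (s2 * y03)" and "p13 = s2 * y13"
  have g2: "g a b 0 d = (p01 * a * b + p13 * b * d - p03 * a * d)\<^sup>2" for a b d
    using s2[of "a * b" "a * d" "b * d"] by (simp add: f2 p03_def p13_def algebra_simps)

  have "(- p02)\<^sup>2 = u02\<^sup>2" using f1[of 1 1 0] g3[of 1 0 1] by simp
  then obtain s1 where s1: "\<And>a b c. (u02 * a + u03 * b + u23 * c)\<^sup>2 = (- p02 * a + (s1 * u03) * b + (s1 * u23) * c)\<^sup>2"
    using square_root_with_leading_coeff[of "- p02" u02 u03 u23] by blast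
  define r p23 where "r = - (s1 * u03)" and "p23 = s1 * u23"
  have g1: "g a 0 c d = (p23 * c * d - p02 * a * c - r * a * d)\<^sup>2" for a c d
    using s1[of "a * c" "a * d" "c * d"] by (simp add: f1 r_def p23_def algebra_simps)

  have "p23\<^sup>2 = w23\<^sup>2" using f0[of 0 1 1] g1[of 0 1 1] by simp
  then obtain s0 where s0: "\<And>a b c. (w23 * a + w13 * b + w12 * c)\<^sup>2 = (p23 * a + (s0 * w13) * b + (s0 * w12) * c)\<^sup>2"
    using square_root_with_leading_coeff[of p23 w23 w13 w12] by blast
  define s t where "s = - (s0 * w13)" and "t = - (s0 * w12)"
  have g0: "g 0 b c d = (p23 * c * d - s * b * d - t * b * c)\<^sup>2" for b c d
    using s0[of "c * d" "b * d" "b * c"] by (simp add: f0 s_def t_def algebra_simps)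

  have r: "r\<^sup>2 = p03\<^sup>2" using g1[of 1 0 1] g2[of 1 0 1] by simp
  have s: "s\<^sup>2 = p13\<^sup>2" using g0[of 1 0 1] g2[of 0 1 1] by simp
  have t: "t\<^sup>2 = p12\<^sup>2" using g0[of 1 1 0] g3[of 0 1 1] by simp

  have "polynomial_in UNIV (\<lambda>Y. F (B *v Y))"
    by (rule polynomial_in_compose[OF poly polynomial_in_matrix_vector])
  moreover have "F (B *v (t *s Y)) = t ^ 4 * F (B *v Y)" for t Y
    by (simp add: vector_scalar_commute hom)
  ultimately obtain e where e: "\<And>a b c d. g a b c d =
      g 0 b c d + g a 0 c d + g a b 0 d + g a b c 0
      - g a b 0 0 - g a 0 c 0 - g a 0 0 d - g 0 b c 0 - g 0 b 0 d - g 0 0 c d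
      + g a 0 0 0 + g 0 b 0 0 + g 0 0 c 0 + g 0 0 0 d + e * a * b * c * d"
    using quartic_determined_by_faces[of "\<lambda>Y. F (B *v Y)"] unfolding g_def by metis
  have G: "g a b c d = (p23 * c * d - s * b * d - t * b * c)\<^sup>2 + (p23 * c * d - p02 * a * c - r * a * d)\<^sup>2
      + (p01 * a * b + p13 * b * d - p03 * a * d)\<^sup>2 + (p01 * a * b + p02 * a * c - p12 * b * c)\<^sup>2
      - (p01 * a * b)\<^sup>2 - (p02 * a * c)\<^sup>2 - (p03 * a * d)\<^sup>2 - (p12 * b * c)\<^sup>2 - (p13 * b * d)\<^sup>2 - (p23 * c * d)\<^sup>2
      + e * a * b * c * d" for a b c d
    using e[of a b c d] by (simp add: g0 g1 g2 g3)

  define X where "X = (\<lambda>i z. (A *v z) $ i)"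
  have X: "polynomial_in UNIV (X i)" for i
    unfolding X_def by (rule polynomial_in_matrix_vector)
  have Xv: "X i (v j) = 0" if "i \<noteq> j" for i j
    using that by (simp add: X_def Av axis_def)
  have FX: "F z = g (X 0 z) (X 1 z) (X 2 z) (X 3 z)" for z
    using Fg[of z] by (simp add: X_def)
  have node: "is_node F (v i)" for i
    using nodes by (simp add: v_def)

  \<comment> \<open>The hypotheses of \<open>cone0\<close>, \<open>cone3\<close> and \<open>cone2\<close> say that the tangent cone at the vertex is the
    square of a linear form with coefficients \<open>m1\<close>, \<open>m2\<close>, \<open>m3\<close>.\<close>
  have cone0: False if "p01\<^sup>2 = m1\<^sup>2" "p02\<^sup>2 = m2\<^sup>2" "r\<^sup>2 = m3\<^sup>2"
      "p01 * p02 = m1 * m2" "- p01 * p03 = m1 * m3" "p02 * r = m2 * m3" for m1 m2 m3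
  proof -
    have "\<not> is_node F (v 0)"
      by (rule not_node_at_vertex[of "X 0" "X 1" "X 2" "X 3" _ _ m1 _ m2 _ m3 _ _ _ F
            "- 2 * p01 * p12" "- 2 * p02 * p12" "t\<^sup>2" "2 * s * t" "- 2 * p23 * t" e
            "2 * p01 * p13" "- 2 * p03 * p13" "s\<^sup>2" "- 2 * p23 * s"
            "- 2 * p02 * p23" "- 2 * p23 * r" "p23\<^sup>2", OF X X X X Xv Xv Xv that])
         (simp_all add: FX G, algebra)
    then show False using node by blast
  qed
  have cone3: False if "r\<^sup>2 = m1\<^sup>2" "s\<^sup>2 = m2\<^sup>2" "p23\<^sup>2 = m3\<^sup>2"
      "- p03 * p13 = m1 * m2" "- p23 * r = m1 * m3" "- p23 * s = m2 * m3" for m1 m2 m3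
  proof -
    have "\<not> is_node F (v 3)"
      by (rule not_node_at_vertex[of "X 3" "X 0" "X 1" "X 2" _ _ m1 _ m2 _ m3 _ _ _ F
            "- 2 * p01 * p03" "2 * p01 * p13" "p01\<^sup>2" "2 * p01 * p02" "- 2 * p01 * p12" e
            "2 * p02 * r" "- 2 * p02 * p23" "p02\<^sup>2" "- 2 * p02 * p12"
            "2 * s * t" "- 2 * p23 * t" "t\<^sup>2", OF X X X X Xv Xv Xv that])
         (simp_all add: FX G, algebra)
    then show False using node by blast
  qed
  have cone2: False if "p02\<^sup>2 = m1\<^sup>2" "t\<^sup>2 = m2\<^sup>2" "p23\<^sup>2 = m3\<^sup>2"
      "- p02 * p12 = m1 * m2" "- p23 * p02 = m1 * m3" "- p23 * t = m2 * m3" for m1 m2 m3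
  proof -
    have "\<not> is_node F (v 2)"
      by (rule not_node_at_vertex[of "X 2" "X 0" "X 1" "X 3" _ _ m1 _ m2 _ m3 _ _ _ F
            "2 * p01 * p02" "- 2 * p01 * p12" "p01\<^sup>2" "- 2 * p01 * p03" "2 * p01 * p13" e
            "2 * p02 * r" "- 2 * p23 * r" "r\<^sup>2" "- 2 * p03 * p13"
            "2 * s * t" "- 2 * p23 * s" "s\<^sup>2", OF X X X X Xv Xv Xv that])
         (simp_all add: FX G, algebra)
    then show False using node by blast
  qed

  \<comment> \<open>A wrong sign or a vanishing coefficient would make one of these cones a square.\<close>
  have r_neq: "r \<noteq> - p03" using cone0[of p01 p02 "- p03"] by auto
  then have r_eq: "r = p03" using r by (simp add: power2_eq_iff)
  have "s \<noteq> - p13" using cone3[of "- p03" p13 p23] by (auto simp: r_eq)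
  then have s_eq: "s = p13" using s by (simp add: power2_eq_iff)
  have "t \<noteq> - p12" using cone2[of "- p02" p12 p23] by auto
  then have t_eq: "t = p12" using t by (simp add: power2_eq_iff)
  show ?thesis
  proof (rule that)
    show "p01 \<noteq> 0" using cone0[of 0 p02 p03] by (auto simp: r_eq)
    show "p02 \<noteq> 0" using cone0[of p01 0 "- p03"] by (auto simp: r_eq)
    show "p03 \<noteq> 0" using r_neq r_eq by auto
    show "p12 \<noteq> 0" using \<open>t \<noteq> - p12\<close> t_eq by auto
    show "p13 \<noteq> 0" using \<open>s \<noteq> - p13\<close> s_eq by auto
    show "p23 \<noteq> 0" using cone3[of "- p03" p13 0] by (auto simp: r_eq s_eq)
    show "F z = tetrahedral_quartic p01 p02 p03 p12 p13 p23 e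
              ((A *v z) $ 0) ((A *v z) $ 1) ((A *v z) $ 2) ((A *v z) $ 3)" for z
      unfolding Fg G tetrahedral_quartic_def r_eq s_eq t_eq by (simp add: algebra_simps)
  qed
qed

section \<open>Rosenhain quartics and Rosenhain tetrahedra\<close>

text \<open>
  With \<open>Y\<^sub>i = t\<^sub>i W\<^sub>i\<close> and \<open>t\<^sub>0 = 1\<close>, equal coefficients on opposite edges mean \<open>p\<^sub>0\<^sub>1 t\<^sub>1 = p\<^sub>2\<^sub>3 t\<^sub>2 t\<^sub>3\<close>,
  \<open>p\<^sub>0\<^sub>2 t\<^sub>2 = p\<^sub>1\<^sub>3 t\<^sub>1 t\<^sub>3\<close> and \<open>p\<^sub>0\<^sub>3 t\<^sub>3 = p\<^sub>1\<^sub>2 t\<^sub>1 t\<^sub>2\<close>.  The products of two of these equations give \<open>t\<^sub>1\<^sup>2\<close>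
  and \<open>t\<^sub>2\<^sup>2\<close>; defining \<open>t\<^sub>3\<close> by the first equation, and not by a third square root, makes the
  signs consistent.
\<close>

lemma tetrahedral_quartic_rescaled:
  assumes nz: "p01 \<noteq> 0" "p02 \<noteq> 0" "p03 \<noteq> 0" "p12 \<noteq> 0" "p13 \<noteq> 0" "p23 \<noteq> 0"
  obtains k :: "4 \<Rightarrow> complex" and a b c d where "\<And>i. k i \<noteq> 0" "a \<noteq> 0"
    "\<And>y. tetrahedral_quartic p01 p02 p03 p12 p13 p23 e (y $ 0) (y $ 1) (y $ 2) (y $ 3)
       = rosenhain_quartic a b c d (\<chi> i. k i * y $ i)"
proof -
  define t1 where "t1 = csqrt (p02 * p03 / (p13 * p12))"
  define t2 where "t2 = csqrt (p01 * p03 / (p23 * p12))"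
  define t3 where "t3 = p01 * t1 / (p23 * t2)"
  have t1: "p13 * p12 * t1\<^sup>2 = p02 * p03" and t2: "p23 * p12 * t2\<^sup>2 = p01 * p03"
    using nz by (simp_all add: t1_def t2_def)
  have nzt: "t1 \<noteq> 0" "t2 \<noteq> 0" "t3 \<noteq> 0"
    using nz by (auto simp: t1_def t2_def t3_def)
  have t3: "p23 * t2 * t3 = p01 * t1"
    using nz nzt by (simp add: t3_def)
  have "p23 * t2 * p12 * (p02 * t2) = p23 * t2 * p12 * (p13 * t1 * t3)"
    using t1 t2 t3 by algebra
  then have b: "p02 * t2 = p13 * t1 * t3"
    using nz nzt by simp
  have "p23 * t2 * (p03 * t3) = p23 * t2 * (p12 * t1 * t2)"
    using t2 t3 by algebra
  then have c: "p03 * t3 = p12 * t1 * t2"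
    using nz nzt by simp
  define d where "d = csqrt (e * t1 * t2 * t3)"
  have d: "d\<^sup>2 = e * t1 * t2 * t3" by (simp add: d_def)
  have eq: "tetrahedral_quartic p01 p02 p03 p12 p13 p23 e w0 (t1 * w1) (t2 * w2) (t3 * w3)
      = rosenhain_quartic (p01 * t1) (p02 * t2) (p03 * t3) d (vec4 w0 w1 w2 w3)" for w0 w1 w2 w3
  proof -
    have terms: "p01 * w0 * (t1 * w1) = p01 * t1 * w0 * w1" "p02 * w0 * (t2 * w2) = p02 * t2 * w0 * w2"
      "p03 * w0 * (t3 * w3) = p03 * t3 * w0 * w3"  "p12 * (t1 * w1) * (t2 * w2) = p03 * t3 * w1 * w2"
      "p13 * (t1 * w1) * (t3 * w3) = p02 * t2 * w1 * w3" "p23 * (t2 * w2) * (t3 * w3) = p01 * t1 * w2 * w3"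
      "e * w0 * (t1 * w1) * (t2 * w2) * (t3 * w3) = d\<^sup>2 * w0 * w1 * w2 * w3"
      using b c d t3 by algebra+
    show ?thesis
      unfolding tetrahedral_quartic_def rosenhain_quartic_def Let_def vec4_nth terms by algebra
  qed
  define k where "k = (\<lambda>i. vec4 1 (1 / t1) (1 / t2) (1 / t3) $ i)"
  show ?thesis
  proof (rule that)
    have "\<forall>i. k i \<noteq> 0" using nzt by (simp add: all_4_from_0 k_def)
    then show "k i \<noteq> 0" for i by blast
    show "p01 * t1 \<noteq> 0" using nz nzt by simp
    fix y :: "complex ^ 4"
    have "(\<chi> i. k i * y $ i) = vec4 (y $ 0) (y $ 1 / t1) (y $ 2 / t2) (y $ 3 / t3)"
      by (rule vec4_eqI) (simp_all add: k_def)
    then show "tetrahedral_quartic p01 p02 p03 p12 p13 p23 e (y $ 0) (y $ 1) (y $ 2) (y $ 3)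
       = rosenhain_quartic (p01 * t1) (p02 * t2) (p03 * t3) d (\<chi> i. k i * y $ i)"
      using eq[of "y $ 0" "y $ 1 / t1" "y $ 2 / t2" "y $ 3 / t3"] nzt by simp
  qed
qed

text \<open>
  The rows of \<open>A\<close> are the equations of the faces, and \<open>A\<close> is invertible because the faces have no
  common point in \<open>\<bbbP>\<^sup>3\<close>.  The columns of \<open>B\<close> are then the vertices.
\<close>

lemma tetrahedron_coordinates:
  assumes "tetrahedron S"
  obtains A B :: "complex ^ 4 ^ 4" and h :: "4 \<Rightarrow> (complex ^ 4) set" where
    "A ** B = mat 1" "B ** A = mat 1" "S = range h" "\<And>i. h i = {z. (A *v z) $ i = 0}"
proof -
  have S: "card S = 4" "\<And>H. H \<in> S \<Longrightarrow> is_plane H" "\<Inter>S = {0}"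
    using assms by (auto simp: tetrahedron_def)
  have "finite S" using S(1) by (metis card.infinite zero_neq_numeral)
  then obtain h where h: "bij_betw h (UNIV :: 4 set) S"
    using S(1) finite_same_card_bij[of "UNIV :: 4 set" S] by auto
  then have S_h: "S = range h" by (auto simp: bij_betw_def)
  have planes: "\<forall>i. \<exists>c. h i = {z. (\<Sum>j\<in>UNIV. c $ j * z $ j) = 0}"
    using S(2) unfolding S_h is_plane_def by blast
  then obtain c where c: "\<And>i. h i = {z. (\<Sum>j\<in>UNIV. c i $ j * z $ j) = 0}"
    using choice[OF planes] by blast
  define A :: "complex ^ 4 ^ 4" where "A = (\<chi> i. c i)"
  have hA: "h i = {z. (A *v z) $ i = 0}" for i
    by (simp add: c A_def matrix_vector_mult_def)
  have "z = 0" if "A *v z = 0" for z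
  proof -
    have "z \<in> \<Inter>S" using that by (auto simp: S_h hA)
    then show ?thesis using S(3) by simp
  qed
  then obtain B where "B ** A = mat 1"
    using matrix_left_invertible_ker[of A] by blast
  then show ?thesis
    using that[of A B h] S_h hA matrix_left_right_inverse by metis
qed

theorem proposition4p50:
  fixes l1 l2 l3 :: complex and S :: "(complex ^ 4) set set"
  assumes "distinct [l1, l2, l3, 0, 1]"
    and "rosenhain_tetrahedron l1 l2 l3 S"
  shows "\<exists>(A :: complex ^ 4 ^ 4) a b c d.
           (a, b, c, d) \<noteq> (0, 0, 0, 0) \<and>
           projective_isomorphism A (cassels_flynn l1 l2 l3) (rosenhain_quartic a b c d) \<and>
           (\<lambda>H. (*v) A ` H) ` S = coordinate_tetrahedron"
proof -
  define F where "F = cassels_flynn l1 l2 l3"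
  have S: "tetrahedron S" "S \<subseteq> tropes l1 l2 l3" "\<And>p. p \<in> vertices S \<Longrightarrow> is_node F p"
    using assms(2) by (auto simp: rosenhain_tetrahedron_def F_def)
  obtain L B and h :: "4 \<Rightarrow> (complex ^ 4) set" where
    LB: "L ** B = mat 1" "B ** L = mat 1" and Sh: "S = range h"
    and h: "\<And>i. h i = {z. (L *v z) $ i = 0}"
    using tetrahedron_coordinates[OF S(1)] by blast
  have "is_node F (B *v axis i 1)" for i
  proof (rule S(3))
    have Lv: "L *v (B *v axis i 1) = axis i 1"
      by (simp add: matrix_vector_mul_assoc LB)
    have "axis i 1 \<noteq> (0 :: complex ^ 4)"
      by (simp add: axis_eq_0_iff)
    then have "B *v axis i 1 \<noteq> 0" using Lv by auto
    moreover have "B *v axis i 1 \<in> \<Inter>(S - {h i})"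
    proof (rule InterI)
      fix H assume "H \<in> S - {h i}"
      then obtain j where "H = h j" "j \<noteq> i" by (auto simp: Sh)
      then show "B *v axis i 1 \<in> H" using Lv by (simp add: h axis_def)
    qed
    ultimately show "B *v axis i 1 \<in> vertices S"
      unfolding vertices_def Sh by blast
  qed
  moreover have "square_on F {z. (L *v z) $ i = 0}" for i
    using S(2) cassels_flynn_square_on_trope[of "h i"] by (auto simp: Sh h F_def)
  moreover have "polynomial_in UNIV F" "\<And>t z. F (t *s z) = t ^ 4 * F z"
    unfolding F_def cassels_flynn_eq_flynn by (rule polynomial_in_flynn flynn_homogeneous)+
  ultimately obtain p01 p02 p03 p12 p13 p23 e where
    p: "p01 \<noteq> 0" "p02 \<noteq> 0" "p03 \<noteq> 0" "p12 \<noteq> 0" "p13 \<noteq> 0" "p23 \<noteq> 0" and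
    F: "\<And>z. F z = tetrahedral_quartic p01 p02 p03 p12 p13 p23 e
              ((L *v z) $ 0) ((L *v z) $ 1) ((L *v z) $ 2) ((L *v z) $ 3)"
    using tetrahedral_normal_form[OF LB, of F] by metis
  obtain k :: "4 \<Rightarrow> complex" and a b c d where k: "\<And>i. k i \<noteq> 0" and a: "a \<noteq> 0" and
    R: "\<And>y. tetrahedral_quartic p01 p02 p03 p12 p13 p23 e (y $ 0) (y $ 1) (y $ 2) (y $ 3)
       = rosenhain_quartic a b c d (\<chi> i. k i * y $ i)"
    by (rule tetrahedral_quartic_rescaled[OF p, of e]) (rule that)
  define A :: "complex ^ 4 ^ 4" where "A = (\<chi> i j. k i * L $ i $ j)"
  have A: "A *v z = (\<chi> i. k i * (L *v z) $ i)" for z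
    by (simp add: A_def matrix_vector_mult_def sum_distrib_left mult.assoc)
  have "z = 0" if "A *v z = 0" for z
  proof -
    have "L *v z = 0" using that k by (simp add: A vec_eq_iff)
    then have "(B ** L) *v z = 0" by (simp flip: matrix_vector_mul_assoc)
    then show ?thesis by (simp add: LB)
  qed
  then obtain A' where A': "A' ** A = mat 1" "A ** A' = mat 1"
    using matrix_left_invertible_ker[of A] matrix_left_right_inverse by blast
  have iso: "projective_isomorphism A F (rosenhain_quartic a b c d)"
    unfolding projective_isomorphism_def
  proof
    show "invertible A" using A' unfolding invertible_def by blast
    show "\<exists>\<kappa>. \<kappa> \<noteq> 0 \<and> (\<forall>z. rosenhain_quartic a b c d (A *v z) = \<kappa> * F z)"
      using R by (intro exI[of _ 1]) (simp add: F A)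
  qed
  have image: "(*v) A ` h i = {Y. Y $ i = 0}" for i
  proof
    show "(*v) A ` h i \<subseteq> {Y. Y $ i = 0}"
      by (auto simp: h A)
    show "{Y. Y $ i = 0} \<subseteq> (*v) A ` h i"
    proof
      fix Y :: "complex ^ 4" assume "Y \<in> {Y. Y $ i = 0}"
      moreover have Y: "Y = A *v (A' *v Y)"
        by (simp add: matrix_vector_mul_assoc A')
      moreover have "(A *v (A' *v Y)) $ i = k i * (L *v (A' *v Y)) $ i"
        by (simp add: A)
      ultimately have "A' *v Y \<in> h i"
        using k[of i] by (simp add: h)
      then show "Y \<in> (*v) A ` h i" using Y by blast
    qed
  qed
  have "(\<lambda>H. (*v) A ` H) ` S = coordinate_tetrahedron"
    unfolding Sh coordinate_tetrahedron_def image_image by (simp only: image)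
  then show ?thesis
    using a iso unfolding F_def by blast
qed

end
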